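(* Let $d\ge2$ be fixed. There is a constant $C_d>0$ depending only on $d$ such that the following holds. Let $D$ be a dataset of $n$ $d$-dimensional tuples with basis $B$, let $k\in\{1,\dots,n\}$, let $S\subseteq D$, let $0<\epsilon<1$, and let $\mathbb{D}=\mathbb{D}_a\cup\mathbb{D}_b$, where $\mathbb{D}_a$ is any finite subset of $\mathbb{S}$ and $\mathbb{D}_b$ is the polar grid with discretization parameter $\gamma=\lceil C_d/\epsilon\rceil$. If $\nabla_{\mathbb{D}}(S)\le k$ and $B\subseteq S$, then for all $u\in\mathbb{S}$, $$w(u,S)\ge(1-\epsilon)\,w_k(u,D).$$
   Context: A dataset $D$ is a set of $n$ distinct tuples in $[0,1]^d$ such that for each attribute $i$ there is a tuple $b_i\in D$ with $b_i[i]=1$ (the $i$-th boundary tuple, one fixed for each $i$); the basis is $B=\{b_1,\dots,b_d\}$. The utility of $t$ for a nonnegative vector $u\in\mathbb{R}^d$ is $w(u,t)=\sum_i u[i]t[i]$; $w_k(u,D)$ is the $k$-th highest utility (with multiplicity) of tuples of $D$ for $u$, and $w(u,S)=\max_{t\in S}w(u,t)$. The rank $\nabla_u(t)$ is one plus the number of $t'\in D$ with $w(u,t')>w(u,t)$; $\nabla_u(S)=\min_{t\in S}\nabla_u(t)$ and $\nabla_{\mathbb{D}}(S)=\max_{u\in\mathbb{D}}\nabla_u(S)$. $\mathbb{S}=\{u\in\mathbb{R}^d: u[i]\ge0\ \forall i,\ \|u\|_2=1\}$. For an integer $\gamma\ge1$, $\mathbb{D}_b\subseteq\mathbb{S}$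 is the image of the grid $\{(\frac{z_1\pi}{2\gamma},\dots,\frac{z_{d-1}\pi}{2\gamma}): z_i\in\{0,1,\dots,\gamma\}\}$ under the polar map $(\theta[1],\dots,\theta[d-1])\mapsto u$, $u[i]=\sin(\theta[d-1])\sin(\theta[d-2])\cdots\sin(\theta[i])\cos(\theta[i-1])$ for $1\le i\le d$, with $\theta[0]=0$. *)

theory Defs
  imports "HOL-Analysis.L2_Norm" "HOL-Library.FuncSet" "HOL-Library.Multiset"
begin

text \<open>
  Vectors of \<open>\<real>\<^sup>d\<close> are functions \<open>nat \<Rightarrow> real\<close> that are extensional on the index set \<open>{1..d}\<close>,
  so that equality of functions is equality of tuples.
\<close>

type_synonym vec = "nat \<Rightarrow> real"

definition utility :: "nat \<Rightarrow> vec \<Rightarrow> vec \<Rightarrow> real" where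
  "utility d u t = (\<Sum>i=1..d. u i * t i)"

definition set_utility :: "nat \<Rightarrow> vec \<Rightarrow> vec set \<Rightarrow> real" where
  "set_utility d u S = Max (utility d u ` S)"

text \<open>
  The multiset image keeps one copy of a utility value for each tuple attaining it.  Only
  meaningful for finite \<open>D\<close> and \<open>1 \<le> k \<le> card D\<close>.
\<close>

definition kth_utility :: "nat \<Rightarrow> nat \<Rightarrow> vec \<Rightarrow> vec set \<Rightarrow> real" where
  "kth_utility d k u D =
     rev (sorted_list_of_multiset (image_mset (utility d u) (mset_set D))) ! (k - 1)"

definition dataset :: "nat \<Rightarrow> nat \<Rightarrow> vec set \<Rightarrow> bool" where
  "dataset d n D \<longleftrightarrow> finite D \<and> card D = n \<and> D \<subseteq> ({1..d} \<rightarrow>\<^sub>E {0..1}) \<and>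
     (\<forall>i\<in>{1..d}. \<exists>t\<in>D. t i = 1)"

text \<open>\<open>b i\<close> is the chosen \<open>i\<close>-th boundary tuple; the \<open>b i\<close> need not be pairwise distinct.\<close>

definition basis_of :: "nat \<Rightarrow> vec set \<Rightarrow> vec set \<Rightarrow> bool" where
  "basis_of d D B \<longleftrightarrow>
     (\<exists>b. (\<forall>i\<in>{1..d}. b i \<in> D \<and> b i i = 1) \<and> B = b ` {1..d})"

definition tuple_rank :: "nat \<Rightarrow> vec set \<Rightarrow> vec \<Rightarrow> vec \<Rightarrow> nat" where
  "tuple_rank d D u t = 1 + card {t' \<in> D. utility d u t' > utility d u t}"

text \<open>The following minimum and maximum are only meaningful for finite nonempty \<open>S\<close> and \<open>V\<close>.\<close>

definition set_rank :: "nat \<Rightarrow> vec set \<Rightarrow> vec \<Rightarrow> vec set \<Rightarrow> nat" where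
  "set_rank d D u S = Min (tuple_rank d D u ` S)"

definition max_rank :: "nat \<Rightarrow> vec set \<Rightarrow> vec set \<Rightarrow> vec set \<Rightarrow> nat" where
  "max_rank d D V S = Max ((\<lambda>u. set_rank d D u S) ` V)"

definition pos_sphere :: "nat \<Rightarrow> vec set" where
  "pos_sphere d = {u \<in> {1..d} \<rightarrow>\<^sub>E UNIV. (\<forall>i\<in>{1..d}. u i \<ge> 0) \<and> L2_set u {1..d} = 1}"

text \<open>The update \<open>\<theta>(0 := 0)\<close> is the convention that the zeroth angle is \<open>0\<close>.\<close>

definition polar_map :: "nat \<Rightarrow> vec \<Rightarrow> vec" where
  "polar_map d \<theta> = (\<lambda>i\<in>{1..d}. (\<Prod>j=i..<d. sin (\<theta> j)) * cos ((\<theta>(0 := 0)) (i - 1)))"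

definition angle_grid :: "nat \<Rightarrow> nat \<Rightarrow> vec set" where
  "angle_grid d \<gamma> =
     {(\<lambda>j\<in>{1..d-1}. real (z j) * pi / (2 * real \<gamma>)) | z. z \<in> {1..d-1} \<rightarrow> {0..\<gamma>}}"

definition polar_grid :: "nat \<Rightarrow> nat \<Rightarrow> vec set" where
  "polar_grid d \<gamma> = polar_map d ` angle_grid d \<gamma>"

end

theory Submission imports Defs begin

text \<open>
  Rounding the polar angles of \<open>u\<close> to the grid moves every coordinate of \<open>u\<close>, and hence every
  utility, by \<open>O(1 / \<gamma>)\<close>.  A tuple of \<open>S\<close> of rank at most \<open>k\<close> for the rounded vector therefore
  has utility at least \<open>w\<^sub>k(u, D) - O(1 / \<gamma>)\<close> for \<open>u\<close>.  The basis makes this additive error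
  relative: some coordinate of \<open>u\<close> is at least \<open>1 / d\<close>, so \<open>w(u, S) \<ge> 1 / d\<close>.
\<close>

section \<open>Polar coordinates\<close>

text \<open>The sine goes with \<open>x\<close> and the cosine with \<open>y\<close> to match the
  polar map, whose last coordinate carries a cosine and whose earlier ones carry the sine of the
  same angle.\<close>

lemma polar_coordinates_plane:
  fixes x y :: real
  assumes "0 \<le> x" "0 \<le> y"
  obtains \<phi> where "\<phi> \<in> {0..pi/2}" "x = sqrt (x\<^sup>2 + y\<^sup>2) * sin \<phi>" "y = sqrt (x\<^sup>2 + y\<^sup>2) * cos \<phi>"
proof (cases "x = 0 \<and> y = 0")
  case True
  then show ?thesis using that[of 0] by simp
next
  case False
  define r where "r = sqrt (x\<^sup>2 + y\<^sup>2)"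
  have pos: "x\<^sup>2 + y\<^sup>2 > 0"
    using False by (simp add: sum_power2_gt_zero_iff)
  then have r: "r > 0" "r\<^sup>2 = x\<^sup>2 + y\<^sup>2"
    by (simp_all add: r_def)
  have "(y / r)\<^sup>2 + (x / r)\<^sup>2 = 1"
    using r(1) by (simp add: power_divide r(2)[symmetric] add.commute flip: add_divide_distrib)
  then obtain \<phi> where "0 \<le> \<phi>" "\<phi> \<le> pi/2" "y / r = cos \<phi>" "x / r = sin \<phi>"
    using sincos_total_pi_half[of "y / r" "x / r"] assms r(1) by auto
  moreover from this have "x = r * sin \<phi>" "y = r * cos \<phi>"
    using r(1) by (simp_all flip: \<open>y / r = cos \<phi>\<close> \<open>x / r = sin \<phi>\<close>)
  ultimately show ?thesis
    using that[of \<phi>] unfolding r_def by auto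
qed

text \<open>Induction on the dimension: the norm of the first coordinates and the new last
  coordinate form a point of the plane quadrant, whose angle becomes the new last angle. The norm is
  kept as a factor because a prefix of a unit vector need not be a unit vector.\<close>

lemma polar_coordinates:
  fixes u :: vec
  assumes "\<forall>i\<in>{1..Suc m}. 0 \<le> u i"
  shows "\<exists>\<theta>. \<theta> 0 = 0 \<and> (\<forall>j. \<theta> j \<in> {0..pi/2}) \<and>
    (\<forall>i\<in>{1..Suc m}. u i = L2_set u {1..Suc m} * ((\<Prod>j=i..<Suc m. sin (\<theta> j)) * cos (\<theta> (i - 1))))"
  using assms
proof (induction m)
  case 0
  then show ?case
    by (intro exI[of _ "\<lambda>_. 0"]) (simp add: L2_set_def)
next
  case (Suc m)
  let ?r = "L2_set u {1..Suc m}"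
  from Suc obtain \<theta> where \<theta>: "\<theta> 0 = 0" "\<And>j. \<theta> j \<in> {0..pi/2}"
    "\<And>i. i \<in> {1..Suc m} \<Longrightarrow> u i = ?r * ((\<Prod>j=i..<Suc m. sin (\<theta> j)) * cos (\<theta> (i - 1)))"
    by auto
  have r': "L2_set u {1..Suc (Suc m)} = sqrt (?r\<^sup>2 + (u (Suc (Suc m)))\<^sup>2)"
    by (simp add: L2_set_def sum_nonneg add_nonneg_nonneg)
  have "0 \<le> u (Suc (Suc m))"
    using Suc.prems by simp
  then obtain \<phi> where \<phi>: "\<phi> \<in> {0..pi/2}" "?r = L2_set u {1..Suc (Suc m)} * sin \<phi>"
    "u (Suc (Suc m)) = L2_set u {1..Suc (Suc m)} * cos \<phi>"
    using polar_coordinates_plane[of ?r "u (Suc (Suc m))"] L2_set_nonneg[of u "{1..Suc m}"]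
    unfolding r' by metis
  show ?case
  \<comment> \<open>The earlier coordinates involve only angles with index at most \<open>m\<close>,
    so the update leaves their old factors alone; they merely gain the factor
    \<open>sin \<phi>\<close>.\<close>
  proof (intro exI[of _ "\<theta>(Suc m := \<phi>)"] conjI ballI allI)
    fix i assume i: "i \<in> {1..Suc (Suc m)}"
    show "u i = L2_set u {1..Suc (Suc m)} *
      ((\<Prod>j=i..<Suc (Suc m). sin ((\<theta>(Suc m := \<phi>)) j)) * cos ((\<theta>(Suc m := \<phi>)) (i - 1)))"
    proof (cases "i = Suc (Suc m)")
      case True
      then show ?thesis using \<phi>(3) by simp
    next
      case False
      with i have i': "i \<in> {1..Suc m}" by auto
      then have "i - 1 \<noteq> Suc m" by auto
      moreover have "(\<Prod>j=i..<Suc m. sin ((\<theta>(Suc m := \<phi>)) j)) = (\<Prod>j=i..<Suc m. sin (\<theta> j))"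
        by (intro prod.cong) auto
      moreover have "u i = L2_set u {1..Suc (Suc m)} * sin \<phi> *
          ((\<Prod>j=i..<Suc m. sin (\<theta> j)) * cos (\<theta> (i - 1)))"
        using \<theta>(3)[OF i'] unfolding \<phi>(2)[symmetric] .
      ultimately show ?thesis
        using i' by (simp add: prod.atLeastLessThan_Suc)
    qed
  qed (use \<theta>(1,2) \<phi>(1) in auto)
qed

lemma pos_sphere_polar_map:
  assumes "u \<in> pos_sphere d" "d \<ge> 1"
  obtains \<theta> where "\<And>j. \<theta> j \<in> {0..pi/2}" "polar_map d \<theta> = u"
proof -
  obtain m where m: "d = Suc m"
    using assms(2) by (cases d) auto
  obtain \<theta> where \<theta>: "\<theta> 0 = 0" "\<And>j. \<theta> j \<in> {0..pi/2}"
    "\<And>i. i \<in> {1..d} \<Longrightarrow> u i = (\<Prod>j=i..<d. sin (\<theta> j)) * cos (\<theta> (i - 1))"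
    using polar_coordinates[of m u] assms(1) unfolding pos_sphere_def m by auto
  have "\<theta>(0 := 0) = \<theta>"
    using \<theta>(1) by auto
  then have "polar_map d \<theta> = u"
    using assms(1) \<theta>(3) by (auto simp: polar_map_def pos_sphere_def PiE_def extensional_def restrict_def)
  with \<theta>(2) that show ?thesis by blast
qed

lemma abs_sin_diff_le: "\<bar>sin x - sin y\<bar> \<le> \<bar>x - y\<bar>" for x y :: real
proof -
  have "\<bar>sin x - sin y\<bar> = 2 * \<bar>sin ((x - y) / 2)\<bar> * \<bar>cos ((x + y) / 2)\<bar>"
    by (simp add: sin_diff_sin abs_mult)
  also have "\<dots> \<le> 2 * \<bar>(x - y) / 2\<bar> * 1"
    using abs_sin_x_le_abs_x[of "(x - y) / 2"] by (intro mult_mono) auto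
  finally show ?thesis by simp
qed

lemma abs_cos_diff_le: "\<bar>cos x - cos y\<bar> \<le> \<bar>x - y\<bar>" for x y :: real
  using abs_sin_diff_le[of "pi/2 - x" "pi/2 - y"] by (simp add: sin_diff)

text \<open>A coordinate is a product of at most \<open>d\<close> sines and cosines, each bounded by
  1 and 1-Lipschitz, so the errors of the factors add up.\<close>

lemma polar_map_lipschitz:
  assumes "\<And>j. j \<in> {1..d-1} \<Longrightarrow> \<bar>\<theta> j - \<phi> j\<bar> \<le> \<delta>" "0 \<le> \<delta>" "i \<in> {1..d}"
  shows "\<bar>polar_map d \<theta> i - polar_map d \<phi> i\<bar> \<le> real d * \<delta>"
proof -
  let ?p = "\<lambda>\<theta>. \<Prod>j=i..<d. sin (\<theta> j)" and ?c = "\<lambda>\<theta>. cos ((\<theta>(0 := 0)) (i - 1))"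
  have le1: "\<bar>?p \<theta>\<bar> \<le> 1" for \<theta> :: vec
    by (simp add: abs_prod prod_le_1)
  have "\<bar>?p \<theta> - ?p \<phi>\<bar> \<le> (\<Sum>j=i..<d. \<bar>sin (\<theta> j) - sin (\<phi> j)\<bar>)"
    using norm_prod_diff[of "{i..<d}" "\<lambda>j. sin (\<theta> j)" "\<lambda>j. sin (\<phi> j)"] by simp
  also have "\<dots> \<le> (\<Sum>j=i..<d. \<delta>)"
    using assms(1,3) by (intro sum_mono order_trans[OF abs_sin_diff_le]) auto
  \<comment> \<open>Since \<open>i \<ge> 1\<close>, there are at most \<open>d - 1\<close> sines;
    the remaining \<open>\<delta>\<close> is reserved for the cosine.\<close>
  also have "\<dots> \<le> (real d - 1) * \<delta>"
    using assms(2,3) by (auto simp: of_nat_diff intro!: mult_right_mono)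
  finally have p: "\<bar>?p \<theta> - ?p \<phi>\<bar> \<le> (real d - 1) * \<delta>" .
  have c: "\<bar>?c \<theta> - ?c \<phi>\<bar> \<le> \<delta>"
  \<comment> \<open>For \<open>i = 1\<close> both cosines are taken at the conventional angle 0,
    about which the hypothesis says nothing.\<close>
  proof (cases "i = 1")
    case True
    then show ?thesis using assms(2) by simp
  next
    case False
    then have "i - 1 \<in> {1..d-1}" "i - 1 \<noteq> 0"
      using assms(3) by auto
    then show ?thesis
      using order_trans[OF abs_cos_diff_le assms(1)] by simp
  qed
  have "\<bar>polar_map d \<theta> i - polar_map d \<phi> i\<bar> = \<bar>(?p \<theta> - ?p \<phi>) * ?c \<theta> + ?p \<phi> * (?c \<theta> - ?c \<phi>)\<bar>"
    using assms(3) by (simp add: polar_map_def algebra_simps)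
  also have "\<dots> \<le> \<bar>?p \<theta> - ?p \<phi>\<bar> * \<bar>?c \<theta>\<bar> + \<bar>?p \<phi>\<bar> * \<bar>?c \<theta> - ?c \<phi>\<bar>"
    unfolding abs_mult[symmetric] by (rule abs_triangle_ineq)
  also have "\<dots> \<le> (real d - 1) * \<delta> * 1 + 1 * \<delta>"
    using p c le1[of \<phi>] by (intro add_mono mult_mono) auto
  finally show ?thesis by (simp add: algebra_simps)
qed

section \<open>The polar grid\<close>

text \<open>The index functions \<open>z\<close> are arbitrary outside \<open>{1..d-1}\<close>;
  restricting them leaves a finite function space with the same image. Finiteness gives the
  \<open>Max\<close> in \<open>max_rank\<close> its meaning.\<close>

lemma finite_polar_grid: "finite (polar_grid d \<gamma>)"
proof -
  let ?g = "\<lambda>z :: nat \<Rightarrow> nat. \<lambda>j\<in>{1..d-1}. real (z j) * pi / (2 * real \<gamma>)"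
  have "angle_grid d \<gamma> \<subseteq> ?g ` ({1..d-1} \<rightarrow>\<^sub>E {0..\<gamma>})"
  proof
    fix \<theta> assume "\<theta> \<in> angle_grid d \<gamma>"
    then obtain z where z: "z \<in> {1..d-1} \<rightarrow> {0..\<gamma>}" "\<theta> = ?g z"
      by (auto simp: angle_grid_def)
    then have "\<theta> = ?g (restrict z {1..d-1})" "restrict z {1..d-1} \<in> {1..d-1} \<rightarrow>\<^sub>E {0..\<gamma>}"
      by auto
    then show "\<theta> \<in> ?g ` ({1..d-1} \<rightarrow>\<^sub>E {0..\<gamma>})" by blast
  qed
  then have "finite (angle_grid d \<gamma>)"
    by (rule finite_subset) (simp add: finite_PiE)
  then show ?thesis
    unfolding polar_grid_def by simp
qed

lemma polar_grid_approx:
  assumes "u \<in> pos_sphere d" "d \<ge> 1" "\<gamma> \<ge> 1"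
  obtains v where "v \<in> polar_grid d \<gamma>"
    "\<And>i. i \<in> {1..d} \<Longrightarrow> \<bar>u i - v i\<bar> \<le> real d * (pi / (2 * real \<gamma>))"
proof -
  obtain \<theta> where \<theta>: "\<And>j. \<theta> j \<in> {0..pi/2}" "polar_map d \<theta> = u"
    using pos_sphere_polar_map assms by blast
  define h where "h = pi / (2 * real \<gamma>)"
  have h: "h > 0" using assms(3) by (simp add: h_def)
  \<comment> \<open>Angles are rounded down to multiples of the grid step \<open>h\<close>. As
    \<open>\<theta> j\<close> lies between 0 and \<open>pi/2 = \<gamma> * h\<close>, the index stays
    in \<open>{0..\<gamma>}\<close> and \<open>nat\<close> truncates nothing.\<close>
  define z where "z j = nat \<lfloor>\<theta> j / h\<rfloor>" for j
  define \<phi> where "\<phi> = (\<lambda>j\<in>{1..d-1}. real (z j) * pi / (2 * real \<gamma>))"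
  have nonneg: "0 \<le> \<theta> j / h" for j
    using \<theta>(1)[of j] h by simp
  have "\<theta> j / h \<le> real \<gamma>" for j
    using \<theta>(1)[of j] assms(3) by (simp add: h_def field_simps)
  then have "\<lfloor>\<theta> j / h\<rfloor> \<le> int \<gamma>" for j
    by (metis floor_mono floor_of_nat)
  then have "z \<in> {1..d-1} \<rightarrow> {0..\<gamma>}"
    by (simp add: z_def nat_le_iff)
  then have "\<phi> \<in> angle_grid d \<gamma>"
    unfolding angle_grid_def \<phi>_def by blast
  moreover have "\<bar>\<theta> j - \<phi> j\<bar> \<le> h" if "j \<in> {1..d-1}" for j
  proof -
    have "real (z j) \<le> \<theta> j / h" "\<theta> j / h \<le> real (z j) + 1"
      using nonneg[of j] unfolding z_def by linarith+
    then have "real (z j) * h \<le> \<theta> j" "\<theta> j \<le> real (z j) * h + h"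
      using h by (simp_all add: field_simps)
    moreover have "\<phi> j = real (z j) * h"
      using that by (simp add: \<phi>_def h_def)
    ultimately show ?thesis by linarith
  qed
  ultimately show ?thesis
    using that[of "polar_map d \<phi>"] polar_map_lipschitz[of d \<theta> \<phi> h] h \<theta>(2)
    by (auto simp: polar_grid_def h_def)
qed

section \<open>Utilities and ranks\<close>

lemma utility_diff_le:
  assumes "\<And>i. i \<in> {1..d} \<Longrightarrow> \<bar>u i - v i\<bar> \<le> \<delta>" "t \<in> {1..d} \<rightarrow>\<^sub>E {0..1}"
  shows "\<bar>utility d u t - utility d v t\<bar> \<le> real d * \<delta>"
proof -
  have "\<bar>utility d u t - utility d v t\<bar> = \<bar>\<Sum>i=1..d. (u i - v i) * t i\<bar>"
    by (simp add: utility_def sum_subtractf left_diff_distrib)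
  also have "\<dots> \<le> (\<Sum>i=1..d. \<bar>u i - v i\<bar> * \<bar>t i\<bar>)"
    unfolding abs_mult[symmetric] by (rule sum_abs)
  also have "\<dots> \<le> (\<Sum>i=1..d. \<delta> * 1)"
    \<comment> \<open>The transitivity rule extracts \<open>0 \<le> \<delta>\<close>, required by
      \<open>mult_mono\<close>, from the bound on an absolute value.\<close>
    using assms by (intro sum_mono mult_mono) (auto simp: PiE_iff intro: order_trans[OF abs_ge_zero])
  finally show ?thesis by simp
qed

text \<open>In the decreasing list of utilities the first \<open>k\<close> entries are all at least
  the \<open>k\<close>-th. Ties can make the count larger than \<open>k\<close>, so only an
  inequality holds.\<close>

lemma le_card_kth_utility:
  assumes "finite D" "1 \<le> k" "k \<le> card D"
  shows "k \<le> card {t \<in> D. kth_utility d k u D \<le> utility d u t}"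
proof -
  define M where "M = image_mset (utility d u) (mset_set D)"
  define ys where "ys = rev (sorted_list_of_multiset M)"
  define c where "c = kth_utility d k u D"
  have c: "c = ys ! (k - 1)"
    by (simp add: c_def kth_utility_def ys_def M_def)
  have mset: "mset ys = M"
    by (simp add: ys_def)
  then have len: "length ys = card D"
    by (metis M_def size_image_mset size_mset size_mset_set)
  have sorted: "sorted (rev ys)"
    by (simp add: ys_def)
  have "c \<le> y" if y: "y \<in> set (take k ys)" for y
  proof -
    obtain j where "j < k" "y = ys ! j"
      using y len assms(3) by (auto simp: in_set_conv_nth)
    then show ?thesis
      using sorted_rev_nth_mono[OF sorted, of j "k - 1"] len assms c by simp
  qed
  then have "filter ((\<le>) c) (take k ys) = take k ys"
    by (simp add: filter_id_conv)
  then have "k = length (filter ((\<le>) c) (take k ys))"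
    using len assms(3) by simp
  also have "\<dots> \<le> length (filter ((\<le>) c) ys)"
    using append_take_drop_id[of k ys] by (metis filter_append length_append le_add1)
  also have "\<dots> = size (filter_mset ((\<le>) c) M)"
    by (metis mset mset_filter size_mset)
  \<comment> \<open>The multiset image has one entry per tuple, so tuples of equal utility are
    counted separately.\<close>
  also have "\<dots> = card {t \<in> D. c \<le> utility d u t}"
    using assms(1) by (simp add: M_def filter_mset_image_mset)
  finally show ?thesis
    by (simp add: c_def)
qed

text \<open>Turns the max-min rank bound into a witness: the minimum over the finite nonempty
  \<open>S\<close> is attained.\<close>

lemma exists_tuple_rank_le:
  assumes "finite V" "v \<in> V" "finite S" "S \<noteq> {}" "max_rank d D V S \<le> k"
  obtains t where "t \<in> S" "tuple_rank d D v t \<le> k"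
proof -
  have "set_rank d D v S \<le> k"
    using assms unfolding max_rank_def by (meson Max_ge finite_imageI image_eqI order_trans)
  moreover have "set_rank d D v S \<in> tuple_rank d D v ` S"
    using assms unfolding set_rank_def by (intro Min_in) auto
  ultimately show ?thesis using that by auto
qed

text \<open>Fewer than \<open>k\<close> tuples beat \<open>t\<close> under \<open>v\<close>, but at
  least \<open>k\<close> reach the \<open>k\<close>-th utility under \<open>u\<close>, so some
  \<open>t'\<close> among the latter does not beat \<open>t\<close> under \<open>v\<close>. Passing
  from \<open>u\<close> to \<open>v\<close> at \<open>t'\<close> and back at \<open>t\<close> costs
  \<open>\<delta>\<close> each time.\<close>

lemma kth_utility_le_of_tuple_rank_le:
  assumes "finite D" "1 \<le> k" "k \<le> card D" "tuple_rank d D v t \<le> k" "t \<in> D"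
    and close: "\<And>t. t \<in> D \<Longrightarrow> \<bar>utility d u t - utility d v t\<bar> \<le> \<delta>"
  shows "kth_utility d k u D \<le> utility d u t + 2 * \<delta>"
proof -
  let ?A = "{t' \<in> D. kth_utility d k u D \<le> utility d u t'}"
  let ?B = "{t' \<in> D. utility d v t < utility d v t'}"
  have "card ?B < card ?A"
    using le_card_kth_utility[OF assms(1-3), of d u] assms(4) by (simp add: tuple_rank_def)
  then have "\<not> ?A \<subseteq> ?B"
    using assms(1) card_mono[of ?B ?A] by auto
  then obtain t' where "t' \<in> D" "kth_utility d k u D \<le> utility d u t'" "utility d v t' \<le> utility d v t"
    by fastforce
  then show ?thesis
    using close[of t] close[of t'] assms(5) by linarith
qed

text \<open>For nonnegative entries the Euclidean norm is at most the sum, so the entries sum to at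
  least 1 and one of them reaches the average \<open>1 / d\<close>.\<close>

lemma pos_sphere_coordinate_ge:
  assumes "u \<in> pos_sphere d"
  obtains i where "i \<in> {1..d}" "1 / real d \<le> u i"
proof (rule ccontr)
  assume "\<not> thesis"
  then have small: "u i < 1 / real d" if "i \<in> {1..d}" for i
    using that \<open>\<And>i. i \<in> {1..d} \<Longrightarrow> 1 / real d \<le> u i \<Longrightarrow> thesis\<close> by force
  have nonneg: "\<forall>i\<in>{1..d}. 0 \<le> u i" and L2: "L2_set u {1..d} = 1"
    using assms by (auto simp: pos_sphere_def)
  have d: "d \<noteq> 0" using L2 by (cases d) auto
  have "1 \<le> (\<Sum>i=1..d. u i)"
    using L2_set_le_sum[of "{1..d}" u] nonneg L2 by simp
  also have "\<dots> < (\<Sum>i=1..d. 1 / real d)"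
    using small d by (intro sum_strict_mono) auto
  finally show False using d by simp
qed

text \<open>The boundary tuple of a large coordinate of \<open>u\<close> suffices: that coordinate
  alone contributes \<open>1 / d\<close>, and the other terms are nonnegative.\<close>

lemma inverse_dim_le_set_utility:
  assumes "u \<in> pos_sphere d" "dataset d n D" "basis_of d D B" "B \<subseteq> S" "S \<subseteq> D"
  shows "1 / real d \<le> set_utility d u S"
proof -
  obtain i where i: "i \<in> {1..d}" "1 / real d \<le> u i"
    using pos_sphere_coordinate_ge assms(1) by blast
  then obtain b where b: "b \<in> S" "b i = 1"
    using assms(3,4) unfolding basis_of_def by blast
  have D: "finite S" "b \<in> {1..d} \<rightarrow>\<^sub>E {0..1}"
    using assms(2,5) b(1) by (auto simp: dataset_def intro: finite_subset)
  have "u i * b i \<le> utility d u b"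
    unfolding utility_def using i(1) D(2) assms(1)
    by (intro member_le_sum) (auto simp: pos_sphere_def PiE_iff)
  also have "\<dots> \<le> set_utility d u S"
    unfolding set_utility_def using b(1) D(1) by simp
  finally show ?thesis using i(2) b(2) by simp
qed

theorem theorem7:
  fixes d :: nat
  assumes "d \<ge> 2"
  shows "\<exists>C::real. C > 0 \<and>
    (\<forall>(n::nat) (D::vec set) (B::vec set) (k::nat) (S::vec set) (\<epsilon>::real) (Da::vec set).
       dataset d n D \<longrightarrow> basis_of d D B \<longrightarrow> k \<in> {1..n} \<longrightarrow> S \<subseteq> D \<longrightarrow>
       0 < \<epsilon> \<longrightarrow> \<epsilon> < 1 \<longrightarrow> finite Da \<longrightarrow> Da \<subseteq> pos_sphere d \<longrightarrow>
       max_rank d D (Da \<union> polar_grid d (nat \<lceil>C / \<epsilon>\<rceil>)) S \<le> k \<longrightarrow> B \<subseteq> S \<longrightarrow>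
       (\<forall>u\<in>pos_sphere d. set_utility d u S \<ge> (1 - \<epsilon>) * kth_utility d k u D))"
proof (intro exI[of _ "real d ^ 3 * pi"] conjI allI impI ballI)
  show "real d ^ 3 * pi > 0" using assms by simp
next
  fix n D B k S \<epsilon> Da u
  assume data: "dataset d n D" and basis: "basis_of d D B" and k: "k \<in> {1..n}" and SD: "S \<subseteq> D"
    and \<epsilon>: "0 < (\<epsilon>::real)" "\<epsilon> < 1" and Da: "finite Da"
    and rank: "max_rank d D (Da \<union> polar_grid d (nat \<lceil>real d ^ 3 * pi / \<epsilon>\<rceil>)) S \<le> k"
    and BS: "B \<subseteq> S" and u: "u \<in> pos_sphere d"
  define \<gamma> where "\<gamma> = nat \<lceil>real d ^ 3 * pi / \<epsilon>\<rceil>"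
  \<comment> \<open>One factor \<open>d\<close> comes from the Lipschitz bound on a coordinate, the
    other from summing \<open>d\<close> coordinates in a utility.\<close>
  define \<delta> where "\<delta> = real d * (real d * (pi / (2 * real \<gamma>)))"
  have C: "0 < real d ^ 3 * pi / \<epsilon>" using assms \<epsilon>(1) by simp
  then have \<gamma>_ge: "real d ^ 3 * pi / \<epsilon> \<le> real \<gamma>" and \<gamma>: "\<gamma> \<ge> 1"
    unfolding \<gamma>_def by linarith+
  \<comment> \<open>This requirement dictates the constant: \<open>2 * \<delta>\<close> equals
    \<open>d^2 * pi / \<gamma>\<close>, which is at most \<open>\<epsilon> / d\<close> once
    \<open>\<gamma> \<ge> d^3 * pi / \<epsilon>\<close>.\<close>
  have \<delta>: "2 * \<delta> \<le> \<epsilon> / real d"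
    using \<gamma>_ge \<gamma> assms \<epsilon>(1) by (simp add: \<delta>_def field_simps power3_eq_cube)
  have fin: "finite D" "card D = n" "D \<subseteq> {1..d} \<rightarrow>\<^sub>E {0..1}"
    using data by (auto simp: dataset_def)
  have S: "finite S" "S \<noteq> {}"
    using fin(1) SD BS basis assms finite_subset by (auto simp: basis_of_def)
  obtain v where v: "v \<in> polar_grid d \<gamma>"
    "\<And>i. i \<in> {1..d} \<Longrightarrow> \<bar>u i - v i\<bar> \<le> real d * (pi / (2 * real \<gamma>))"
    using polar_grid_approx[OF u _ \<gamma>] assms by auto
  obtain t where t: "t \<in> S" "tuple_rank d D v t \<le> k"
    using exists_tuple_rank_le[OF _ _ S rank, of v] Da finite_polar_grid v(1) by (auto simp: \<gamma>_def)
  have "kth_utility d k u D \<le> utility d u t + 2 * \<delta>"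
  proof (rule kth_utility_le_of_tuple_rank_le[OF fin(1) _ _ t(2)])
    show "\<bar>utility d u t' - utility d v t'\<bar> \<le> \<delta>" if "t' \<in> D" for t'
      unfolding \<delta>_def by (rule utility_diff_le[OF v(2)]) (use that fin(3) in auto)
  qed (use fin(2) k t(1) SD in auto)
  also have "\<dots> \<le> set_utility d u S + \<epsilon> / real d"
    using t(1) S(1) \<delta> by (intro add_mono) (auto simp: set_utility_def)
  finally have add: "kth_utility d k u D \<le> set_utility d u S + \<epsilon> * (1 / real d)" by simp
  have low: "1 / real d \<le> set_utility d u S"
    using inverse_dim_le_set_utility u data basis BS SD by blast
  show "(1 - \<epsilon>) * kth_utility d k u D \<le> set_utility d u S"
  \<comment> \<open>If \<open>S\<close> already attains the \<open>k\<close>-th utility, the factor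
    \<open>1 - \<epsilon>\<close> only helps, as the utility of \<open>S\<close> is nonnegative.
    Otherwise the \<open>k\<close>-th utility exceeds that of \<open>S\<close>, hence
    \<open>1 / d\<close>, and the additive error is at most \<open>\<epsilon>\<close> times the
    \<open>k\<close>-th utility.\<close>
  proof (cases "kth_utility d k u D \<le> set_utility d u S")
    case True
    have "0 \<le> set_utility d u S"
      using low by (rule order_trans[rotated]) simp
    then have "(1 - \<epsilon>) * set_utility d u S \<le> set_utility d u S"
      using \<epsilon> by (simp add: mult_left_le_one_le)
    moreover have "(1 - \<epsilon>) * kth_utility d k u D \<le> (1 - \<epsilon>) * set_utility d u S"
      using True \<epsilon> by (intro mult_left_mono) auto
    ultimately show ?thesis by linarith
  next
    case False
    then have "\<epsilon> * (1 / real d) \<le> \<epsilon> * kth_utility d k u D"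
      using low \<epsilon> by (intro mult_left_mono) auto
    with add show ?thesis by (simp add: algebra_simps)
  qed
qed

end
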